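(* Let $r>2$ be an integer, let $d\in\{0,1,\dots,r-1\}$, and let $v_{r,d}$ be the set of positive integers whose base-$r$ expansion does not contain the digit $d$. For real $x$ define $\zeta_{r,d}(x):=\sum_{v\in v_{r,d}} v^{-x}$. Then $\zeta_{r,d}(x)$ is convergent if $x>\frac{\log(r-1)}{\log r}$ and divergent if $x\le \frac{\log(r-1)}{\log r}$. *)

theory Defs
  imports "HOL-Analysis.Analysis"
begin

text \<open>
  The digits of \<open>n\<close> in base \<open>r\<close>, least significant first and without leading zeros.
  The expansion of 0 is the empty list; bases below 2 are degenerate and also yield the empty list.
\<close>

function base_digits :: "nat \<Rightarrow> nat \<Rightarrow> nat list" where
  "base_digits r n =
     (if r \<le> 1 \<or> n = 0 then [] else n mod r # base_digits r (n div r))"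
  by pat_completeness auto
termination
  by (relation "Wellfounded.measure snd") (auto simp: div_less_dividend)

declare base_digits.simps [simp del]

lemma base_digits_less:
  assumes "x \<in> set (base_digits r n)"
  shows "x < r"
  using assms
proof (induction r n rule: base_digits.induct)
  case (1 r n)
  then show ?case
    by (subst (asm) (2) base_digits.simps) (auto split: if_splits)
qed

lemma horner_sum_base_digits:
  assumes "r > 1"
  shows "horner_sum id r (base_digits r n) = n"
  using assms
proof (induction r n rule: base_digits.induct)
  case (1 r n)
  then show ?case
    by (subst base_digits.simps) (auto simp: id_def)
qed

lemma last_base_digits:
  assumes "r > 1" "n > 0"
  shows "last (base_digits r n) \<noteq> 0"
  using assms
proof (induction r n rule: base_digits.induct)
  case (1 r n)
  show ?case
  proof (cases "n < r")
    case True
    then show ?thesis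
      using "1.prems" by (simp add: base_digits.simps[of r n] base_digits.simps[of r 0])
  next
    case False
    then have pos: "n div r > 0"
      using "1.prems" by (simp add: div_greater_zero_iff)
    then have "base_digits r (n div r) \<noteq> []"
      using "1.prems" by (simp add: base_digits.simps[of r "n div r"])
    then show ?thesis
      using "1.IH" "1.prems" pos by (simp add: base_digits.simps[of r n])
  qed
qed

definition missing_digit :: "nat \<Rightarrow> nat \<Rightarrow> nat set" where
  "missing_digit r d = {v. v > 0 \<and> d \<notin> set (base_digits r v)}"

end

theory Submission
  imports Defs
begin

text \<open>
  Split the integers missing the digit \<open>d\<close> by length: those in \<open>{r ^ k..<r ^ Suc k}\<close>. Appending a
  digit other than \<open>d\<close> multiplies the number of such integers by \<open>r - 1\<close>, so the block \<open>k\<close> has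
  \<open>a (r - 1) ^ k\<close> elements for some \<open>a > 0\<close>. Its contribution to the series is therefore, up to a
  factor independent of \<open>k\<close>, the power \<open>((r - 1) / r powr x) ^ k\<close>, and the series behaves like a
  geometric one whose ratio is less than 1 exactly if \<open>x > ln (r - 1) / ln r\<close>.
\<close>

text \<open>For nonnegative terms summability only asks for bounded finite sums, and every finite
  subset of the union already lies in finitely many of the \<open>A k\<close>.\<close>

lemma summable_on_UN_nonneg_iff:
  fixes f :: "'a \<Rightarrow> real" and A :: "nat \<Rightarrow> 'a set"
  assumes fin: "\<And>k. finite (A k)" and disj: "disjoint_family A"
    and nonneg: "\<And>v. v \<in> (\<Union>k. A k) \<Longrightarrow> f v \<ge> 0"
  shows "f summable_on (\<Union>k. A k) \<longleftrightarrow> summable (\<lambda>k. sum f (A k))"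
proof -
  have block: "sum f (A k) \<ge> 0" for k
    using nonneg by (intro sum_nonneg) auto
  have partial: "sum f (\<Union>k<n. A k) = (\<Sum>k<n. sum f (A k))" for n
    using fin disj by (intro sum.UNION_disjoint) (auto simp: disjoint_family_on_def)
  show ?thesis
  proof
    assume f: "f summable_on (\<Union>k. A k)"
    have "(\<Sum>k<n. sum f (A k)) \<le> infsum f (\<Union>k. A k)" for n
      unfolding partial[symmetric] using f fin nonneg
      by (intro finite_sum_le_infsum) auto
    then show "summable (\<lambda>k. sum f (A k))"
      using block by (intro summableI_nonneg_bounded)
  next
    assume s: "summable (\<lambda>k. sum f (A k))"
    show "f summable_on (\<Union>k. A k)"
    proof (rule nonneg_bdd_above_summable_on)
      show "bdd_above (sum f ` {F. F \<subseteq> (\<Union>k. A k) \<and> finite F})"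
      proof (rule bdd_aboveI2)
        fix F assume "F \<in> {F. F \<subseteq> (\<Union>k. A k) \<and> finite F}"
        then have F: "F \<subseteq> (\<Union>k. A k)" "finite F" by auto
        from F(1) obtain g where g: "\<And>v. v \<in> F \<Longrightarrow> v \<in> A (g v)"
          by (metis UN_E subsetD)
        \<comment> \<open>Inserting 0 keeps \<open>Max\<close> meaningful for empty
          \<open>F\<close>.\<close>
        define n where "n = Suc (Max (insert 0 (g ` F)))"
        have "g v < n" if "v \<in> F" for v
          using F(2) that by (auto simp: n_def less_Suc_eq_le)
        with g have "F \<subseteq> (\<Union>k<n. A k)" by blast
        then have "sum f F \<le> sum f (\<Union>k<n. A k)"
          using fin nonneg by (intro sum_mono2) auto
        also have "\<dots> \<le> (\<Sum>k. sum f (A k))"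
          unfolding partial using s block by (intro sum_le_suminf) auto
        finally show "sum f F \<le> (\<Sum>k. sum f (A k))" .
      qed
    qed (use nonneg in auto)
  qed
qed

lemma base_digits_append_digit:
  assumes "r > 1" "u > 0" "c < r"
  shows "base_digits r (u * r + c) = c # base_digits r u"
  using assms by (subst base_digits.simps) auto

text \<open>The index \<open>k\<close> stands for \<open>Suc k\<close> digits, so block 0 consists
  of single nonzero digits.\<close>

definition missing_digit_block :: "nat \<Rightarrow> nat \<Rightarrow> nat \<Rightarrow> nat set" where
  "missing_digit_block r d k = missing_digit r d \<inter> {r ^ k..<r ^ Suc k}"

lemma finite_missing_digit_block: "finite (missing_digit_block r d k)"
  by (simp add: missing_digit_block_def)

text \<open>Division with remainder by \<open>r\<close> splits off the last digit. The remaining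
  prefix is at least \<open>r ^ k\<close>, hence positive, so the new digit may be any one except
  \<open>d\<close>, including 0.\<close>

lemma missing_digit_block_Suc:
  assumes "r > 1"
  shows "missing_digit_block r d (Suc k) =
    (\<lambda>(u, c). u * r + c) ` (missing_digit_block r d k \<times> ({..<r} - {d}))"
    (is "?L = ?h ` ?R")
proof (intro set_eqI iffI)
  fix v assume v: "v \<in> ?L"
  define u where "u = v div r"
  define c where "c = v mod r"
  have v_eq: "v = u * r + c" and c: "c < r"
    using assms by (auto simp: u_def c_def)
  have lo: "r ^ k \<le> u" and hi: "u < r ^ Suc k"
    using v assms unfolding u_def
    by (auto simp: missing_digit_block_def less_eq_div_iff_mult_less_eq div_less_iff_less_mult mult.commute)
  then have u: "u > 0"
    using assms by (cases u) auto
  have "d \<notin> set (base_digits r v)"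
    using v by (simp add: missing_digit_block_def missing_digit_def)
  then have "(u, c) \<in> ?R"
    using lo hi u c base_digits_append_digit[OF assms u c]
    by (auto simp: v_eq missing_digit_block_def missing_digit_def)
  then show "v \<in> ?h ` ?R"
    using v_eq by force
next
  fix v assume "v \<in> ?h ` ?R"
  then obtain u c where v_eq: "v = u * r + c" and u: "u \<in> missing_digit_block r d k"
    and c: "c < r" "c \<noteq> d" by auto
  \<comment> \<open>The upper bound is stated for \<open>Suc u\<close> to leave room for the digit:
    \<open>u * r + c < Suc u * r\<close>.\<close>
  have "r ^ k \<le> u" "Suc u \<le> r ^ Suc k" "u > 0"
    using u by (auto simp: missing_digit_block_def missing_digit_def)
  moreover from this have "r ^ k * r \<le> u * r" "Suc u * r \<le> r ^ Suc k * r"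
    by (simp_all only: mult_le_mono1)
  with c have "r ^ Suc k \<le> v" "v < r ^ Suc (Suc k)"
    unfolding v_eq power_Suc2[of r] mult_Suc by linarith+
  ultimately show "v \<in> ?L"
    using u c base_digits_append_digit[OF assms, of u c]
    by (simp add: missing_digit_block_def missing_digit_def v_eq)
qed

lemma card_missing_digit_block_Suc:
  assumes "r > 1" "d < r"
  shows "card (missing_digit_block r d (Suc k)) = card (missing_digit_block r d k) * (r - 1)"
proof -
  have "inj_on (\<lambda>(u, c). u * r + c) (missing_digit_block r d k \<times> ({..<r} - {d}))"
  proof (rule inj_on_inverseI)
    show "(\<lambda>v. (v div r, v mod r)) ((\<lambda>(u, c). u * r + c) p) = p"
      if "p \<in> missing_digit_block r d k \<times> ({..<r} - {d})" for p
      using that by auto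
  qed
  then show ?thesis
    using assms by (simp add: missing_digit_block_Suc card_image card_cartesian_product)
qed

lemma card_missing_digit_block:
  assumes "r > 1" "d < r"
  shows "card (missing_digit_block r d k) = card (missing_digit_block r d 0) * (r - 1) ^ k"
  using assms by (induction k) (simp_all add: card_missing_digit_block_Suc mult_ac)

lemma card_missing_digit_block_0_pos:
  assumes "r > 2"
  shows "card (missing_digit_block r d 0) > 0"
proof -
  \<comment> \<open>The digit 2 exists because \<open>r > 2\<close>; for \<open>r = 2\<close> and
    \<open>d = 1\<close> the block would be empty.\<close>
  have "(if d = 1 then 2 else 1) \<in> missing_digit_block r d 0"
    using assms
    by (auto simp: missing_digit_block_def missing_digit_def base_digits.simps[of r 0]
        base_digits.simps[of r 1] base_digits.simps[of r "Suc 0"] base_digits.simps[of r 2])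
  then show ?thesis
    using finite_missing_digit_block card_gt_0_iff by blast
qed

lemma disjoint_family_missing_digit_block:
  assumes "r > 1"
  shows "disjoint_family (missing_digit_block r d)"
proof -
  have "k = l" if "r ^ k \<le> v" "v < r ^ Suc k" "r ^ l \<le> v" "v < r ^ Suc l" for k l v
  proof -
    have "r ^ k < r ^ Suc l" "r ^ l < r ^ Suc k"
      using that by linarith+
    then have "k < Suc l" "l < Suc k"
      using assms power_less_imp_less_exp by blast+
    then show ?thesis by simp
  qed
  then show ?thesis
    unfolding disjoint_family_on_def missing_digit_block_def by auto
qed

lemma missing_digit_eq_UN_block:
  assumes "r > 1"
  shows "missing_digit r d = (\<Union>k. missing_digit_block r d k)"
proof -
  have "\<exists>k. r ^ k \<le> v \<and> v < r ^ Suc k" if "v > 0" for v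
    using ex_power_ivl1[of r v] assms that by auto
  then show ?thesis
    by (fastforce simp: missing_digit_block_def missing_digit_def)
qed

text \<open>With \<open>b = r\<close> and \<open>c = r - 1\<close> this turns the comparison of
  \<open>x\<close> with the critical exponent into that of the ratio \<open>q\<close> with 1, for
  convergence and divergence alike.\<close>

lemma less_ln_divide_ln_iff:
  fixes x b c :: real
  assumes "b > 1" "c > 0"
  shows "ln c / ln b < x \<longleftrightarrow> c < b powr x"
  using assms by (metis less_log_iff log_def log_less_iff)

theorem theorem2:
  fixes r d :: nat and x :: real
  assumes "r > 2" and "d \<in> {0..r - 1}"
  shows "(x > ln (real r - 1) / ln (real r) \<longrightarrow>
            (\<lambda>v. real v powr (- x)) summable_on missing_digit r d) \<and>
         (x \<le> ln (real r - 1) / ln (real r) \<longrightarrow>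
            \<not> (\<lambda>v. real v powr (- x)) summable_on missing_digit r d)"
proof -
  have r: "r > 1" and d: "d < r" using assms by auto
  define f where "f = (\<lambda>v::nat. real v powr (- x))"
  define B where "B = missing_digit_block r d"
  define a where "a = card (B 0)"
  define q where "q = (real r - 1) / real r powr x"
  have a: "a > 0"
    using card_missing_digit_block_0_pos[OF assms(1)] by (simp add: a_def B_def)
  have q: "q > 0" using r by (simp add: q_def)
  have fin: "finite (B k)" for k
    by (simp add: B_def finite_missing_digit_block)
  have card_B: "real (card (B k)) = a * (real r - 1) ^ k" for k
    using card_missing_digit_block[OF r d, of k] r by (simp add: a_def B_def of_nat_diff)
  \<comment> \<open>Replacing every \<open>v\<close> in block \<open>k\<close> by its lower end
    \<open>r ^ k\<close> gives an exactly geometric sequence; both halves compare the block sums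
    with it.\<close>
  have geometric: "real (card (B k)) * (real r ^ k) powr (- x) = a * q ^ k" for k
  proof -
    have "(real r ^ k) powr (- x) = 1 / (real r powr x) ^ k"
      using r by (simp add: powr_minus_divide powr_power powr_realpow[symmetric] powr_powr mult.commute)
    then show ?thesis
      by (simp add: card_B q_def power_divide)
  qed
  have summable_iff: "f summable_on missing_digit r d \<longleftrightarrow> summable (\<lambda>k. sum f (B k))"
    unfolding missing_digit_eq_UN_block[OF r] B_def
    by (intro summable_on_UN_nonneg_iff)
      (auto simp: f_def finite_missing_digit_block disjoint_family_missing_digit_block[OF r])
  have bounds: "real r ^ k \<le> real v" "real v \<le> real r ^ Suc k" "real v > 0" if "v \<in> B k" for k v
    using that unfolding B_def missing_digit_block_def missing_digit_def
    by (auto simp flip: of_nat_power of_nat_mult)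
  have "f summable_on missing_digit r d" if x: "x > ln (real r - 1) / ln (real r)"
  proof -
    \<comment> \<open>The critical exponent is positive since \<open>r - 1 > 1\<close>. With
      \<open>x > 0\<close> the terms decrease in \<open>v\<close>, so the value at
      \<open>r ^ k\<close> bounds every term of block \<open>k\<close> from above.\<close>
    have "x > 0"
    proof (rule less_trans[OF _ x])
      show "0 < ln (real r - 1) / ln (real r)"
        using assms(1) by (intro divide_pos_pos ln_gt_zero) auto
    qed
    have "q < 1"
      using x r less_ln_divide_ln_iff[of "real r" "real r - 1" x] by (simp add: q_def)
    have le: "sum f (B k) \<le> a * q ^ k" for k
    proof -
      have "sum f (B k) \<le> card (B k) * (real r ^ k) powr (- x)"
        unfolding f_def using \<open>x > 0\<close> r bounds
        by (intro sum_bounded_above powr_mono2') auto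
      then show ?thesis by (simp add: geometric)
    qed
    have "summable (\<lambda>k. sum f (B k))"
    proof (rule summable_comparison_test')
      show "summable (\<lambda>k. a * q ^ k)"
        using q \<open>q < 1\<close> by (intro summable_mult summable_geometric) simp
      show "norm (sum f (B k)) \<le> a * q ^ k" for k
        using le[of k] by (simp add: f_def sum_nonneg)
    qed
    then show ?thesis by (simp add: summable_iff)
  qed
  moreover have "\<not> f summable_on missing_digit r d" if x: "x \<le> ln (real r - 1) / ln (real r)"
  proof
    assume "f summable_on missing_digit r d"
    \<comment> \<open>The contradiction will come from a positive lower bound \<open>a * m\<close>
      on all block sums.\<close>
    then have lim: "(\<lambda>k. sum f (B k)) \<longlonglongrightarrow> 0"
      by (simp add: summable_iff summable_LIMSEQ_zero)
    have "q \<ge> 1"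
      using x r less_ln_divide_ln_iff[of "real r" "real r - 1" x] by (simp add: q_def)
    define m where "m = min 1 (real r powr (- x))"
    have "m > 0" using r by (simp add: m_def)
    have "a * m \<le> sum f (B k)" for k
    proof -
      \<comment> \<open>The minimum covers both signs of \<open>x\<close>.\<close>
      have "(real r ^ k) powr (- x) * m \<le> f v" if v: "v \<in> B k" for v
      proof (cases "x \<ge> 0")
        case True
        \<comment> \<open>Here the terms do not increase in \<open>v\<close>, so the upper end
          \<open>r ^ Suc k\<close> gives the lower bound, at the cost of a factor
          \<open>real r powr (- x)\<close>.\<close>
        have "(real r ^ k) powr (- x) * m \<le> (real r ^ k) powr (- x) * real r powr (- x)"
          by (intro mult_left_mono) (auto simp: m_def)
        also have "\<dots> = (real r ^ Suc k) powr (- x)"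
          by (simp add: powr_mult mult.commute)
        also have "\<dots> \<le> f v"
          unfolding f_def using True bounds[OF v] by (intro powr_mono2') auto
        finally show ?thesis .
      next
        case False
        \<comment> \<open>For negative \<open>x\<close> the terms increase, and the lower end
          \<open>r ^ k\<close> itself gives the bound.\<close>
        have "(real r ^ k) powr (- x) * m \<le> (real r ^ k) powr (- x) * 1"
          by (intro mult_left_mono) (auto simp: m_def)
        also have "\<dots> \<le> f v"
          unfolding f_def using False bounds[OF v] by (auto intro: powr_mono2)
        finally show ?thesis .
      qed
      then have "card (B k) * ((real r ^ k) powr (- x) * m) \<le> sum f (B k)"
        by (intro sum_bounded_below)
      then have "a * q ^ k * m \<le> sum f (B k)"
        using geometric[of k] by (simp add: mult.assoc[symmetric])
      moreover have "real a * 1 * m \<le> real a * q ^ k * m"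
        using \<open>q \<ge> 1\<close> \<open>m > 0\<close> by (intro mult_right_mono mult_left_mono one_le_power) auto
      ultimately show ?thesis by simp
    qed
    then have "a * m \<le> 0"
      by (intro LIMSEQ_le_const[OF lim]) auto
    then show False
      using a \<open>m > 0\<close> by (simp add: mult_le_0_iff)
  qed
  ultimately show ?thesis by (simp add: f_def)
qed

end
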